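(* $\mathcal{EE}\cap\mathscr{B}=\mathfrak{P}_2\cap\mathscr{B}$.
   Context: $2^\omega$ is the Cantor space with its standard product probability measure, $[\omega]^\omega$ is the family of infinite subsets of $\omega$, and $\mathscr{B}$ is the class of all Borel subsets of $2^\omega$. $\mathcal{E}$ is the $\sigma$-ideal on $2^\omega$ generated by closed null subsets of $2^\omega$ (i.e. all subsets of countable unions of closed null sets). For $S\in[\omega]^\omega$ with increasing enumeration $S=\{s_0<s_1<\dots\}$, let $\tilde s:2^\omega\to 2^S$ be the bijection $\tilde s(x)(s_i)=x(i)$, and for $A\subseteq 2^S$ let $A\in\mathcal{E}(2^S)$ iff $\tilde s^{-1}[A]\in\mathcal{E}$. For $X\subseteq 2^\omega$, $X\restriction S=\{x\restriction S:x\in X\}\subseteq 2^S$. Define $\mathcal{EE}=\{X\subseteq 2^\omega:(\forall S\in[\omega]^\omega)\ X\restriction S\in\mathcal{E}(2^S)\}$ and $\mathfrak{P}_2=\{X\subseteq 2^\omega:(\forall S\in[\omega]^\omega)\ X\restriction S\neq 2^S\}$. *)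

theory Defs
  imports "HOL-Probability.Probability" "HOL-Library.Infinite_Set"
begin

text \<open>
  The Cantor space is the type \<^typ>\<open>nat \<Rightarrow> bool\<close> with its library topology, the product of the
  discrete topologies on \<^typ>\<open>bool\<close>; its Borel sets are \<^term>\<open>sets (borel :: (nat \<Rightarrow> bool) measure)\<close>.
\<close>

definition cantor_measure :: "(nat \<Rightarrow> bool) measure" where
  "cantor_measure = (\<Pi>\<^sub>M i\<in>UNIV. measure_pmf (bernoulli_pmf (1/2)))"

definition ideal_E :: "(nat \<Rightarrow> bool) set set" where
  "ideal_E = {X. \<exists>C :: nat \<Rightarrow> (nat \<Rightarrow> bool) set.
      (\<forall>n. closed (C n) \<and> C n \<in> null_sets cantor_measure) \<and> X \<subseteq> (\<Union>n. C n)}"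

text \<open>
  Elements of $2^S$ are represented as extensional functions, i.e. functions on \<^typ>\<open>nat\<close> that
  take the value \<^term>\<open>undefined\<close> outside \<open>S\<close>; \<^term>\<open>restrict x S\<close> is then the restriction
  of \<open>x\<close> to \<open>S\<close>.
\<close>

definition cantor_on :: "nat set \<Rightarrow> (nat \<Rightarrow> bool) set" where
  "cantor_on S = S \<rightarrow>\<^sub>E (UNIV :: bool set)"

definition restr :: "(nat \<Rightarrow> bool) set \<Rightarrow> nat set \<Rightarrow> (nat \<Rightarrow> bool) set" where
  "restr X S = (\<lambda>x. restrict x S) ` X"

text \<open>
  For infinite \<open>S\<close>, \<^term>\<open>enumerate S\<close> is the increasing enumeration of \<open>S\<close>, and \<open>tilde S\<close> is
  the map $\tilde s$.
\<close>

definition tilde :: "nat set \<Rightarrow> (nat \<Rightarrow> bool) \<Rightarrow> (nat \<Rightarrow> bool)" where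
  "tilde S x = (\<lambda>n\<in>S. x (inv (enumerate S) n))"

lemma tilde_enumerate:
  assumes "infinite S"
  shows "tilde S x (enumerate S i) = x i"
proof -
  have "inj (enumerate S)"
    using strict_mono_enumerate[OF assms] by (rule strict_mono_imp_inj_on)
  then have "inv (enumerate S) (enumerate S i) = i"
    by (rule inv_f_f)
  with enumerate_in_set[OF assms] show ?thesis
    by (simp add: tilde_def)
qed

lemma bij_betw_tilde:
  assumes "infinite S"
  shows "bij_betw (tilde S) UNIV (cantor_on S)"
proof (rule bij_betw_byWitness[where f' = "\<lambda>y i. y (enumerate S i)"])
  show "\<forall>x\<in>UNIV. (\<lambda>i. tilde S x (enumerate S i)) = x"
    by (simp add: tilde_enumerate[OF assms])
  show "\<forall>y\<in>cantor_on S. tilde S (\<lambda>i. y (enumerate S i)) = y"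
  proof (intro ballI ext)
    fix y n assume y: "y \<in> cantor_on S"
    show "tilde S (\<lambda>i. y (enumerate S i)) n = y n"
    proof (cases "n \<in> S")
      case True
      then have "enumerate S (inv (enumerate S) n) = n"
        by (intro f_inv_into_f) (simp only: range_enumerate[OF assms])
      with True show ?thesis by (simp add: tilde_def)
    next
      case False
      then show ?thesis
        using PiE_arb[OF y[unfolded cantor_on_def] False] by (simp add: tilde_def)
    qed
  qed
  show "tilde S ` UNIV \<subseteq> cantor_on S"
    by (auto simp add: tilde_def cantor_on_def)
qed simp

definition ideal_E_on :: "nat set \<Rightarrow> (nat \<Rightarrow> bool) set set" where
  "ideal_E_on S = {A. A \<subseteq> cantor_on S \<and> tilde S -` A \<in> ideal_E}"

definition class_EE :: "(nat \<Rightarrow> bool) set set" where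
  "class_EE = {X. \<forall>S. infinite S \<longrightarrow> restr X S \<in> ideal_E_on S}"

definition class_P2 :: "(nat \<Rightarrow> bool) set set" where
  "class_P2 = {X. \<forall>S. infinite S \<longrightarrow> restr X S \<noteq> cantor_on S}"

end

theory Submission
  imports Defs
begin

text \<open>
  The inclusion of \<open>class_EE\<close> in \<open>class_P2\<close> holds for arbitrary sets: $2^S$ is not in
  $\mathcal{E}(2^S)$, because the Cantor space has measure one.

  For the converse, let \<open>X\<close> be Borel, hence analytic, and suppose that its restriction to some
  infinite \<open>S\<close> is not in \<open>\<E>\<close>. Identify $2^S$ with the Cantor space; the restriction becomes
  \<open>h ` C\<close> with \<open>C\<close> closed in the Baire space and \<open>h\<close> continuous. The task is to find infinitely
  many coordinates \<open>t 0 < t 1 < ...\<close> such that the values of \<open>h z\<close> at these coordinates, for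
  \<open>z \<in> C\<close>, form every possible 0-1 sequence. Two facts make this work.

  First, a set outside \<open>\<E>\<close> takes both values at all but finitely many coordinates
  (\<open>eventually_both_values_of_notin_ideal_E\<close>). Otherwise its elements would be constrained at
  infinitely many coordinates to prescribed values, and such points form a closed null set.

  Second, since \<open>\<E>\<close> is a \<open>\<sigma>\<close>-ideal and the Baire space has a countable base, \<open>C\<close> contains a
  nonempty set \<open>B\<close> such that every basic neighbourhood of every point of \<open>B\<close> meets \<open>B\<close> in a set
  whose image is outside \<open>\<E>\<close> (\<open>everywhere_large_kernel\<close>).

  A fusion then builds a binary tree of shrinking basic neighbourhoods of points of \<open>B\<close>. At each
  level there are finitely many of them, so one new coordinate \<open>t n\<close> serves them all: inside each,
  both values at \<open>t n\<close> are attained, and by continuity each value persists on a smaller basic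
  neighbourhood. Along a branch more and more entries of the points are fixed, so the points converge
  in the Baire space, to a limit in \<open>C\<close> because \<open>C\<close> is closed. Hence the restriction of \<open>X\<close> to
  the corresponding infinite subset of \<open>S\<close> is onto, and \<open>X\<close> is not in \<open>class_P2\<close>.
\<close>

section \<open>The ideal \<open>\<E>\<close> and coordinates\<close>

instance bool :: second_countable_topology
proof
  have "open = generate_topology (UNIV :: bool set set)"
    by (auto simp: fun_eq_iff discrete_topology_class.open_discrete intro: generate_topology.Basis)
  then show "\<exists>B :: bool set set. countable B \<and> open = generate_topology B"
    by (intro exI[of _ UNIV]) (auto intro: countable_finite)
qed

lemma sets_cantor_measure: "sets cantor_measure = sets (borel :: (nat \<Rightarrow> bool) measure)"
proof -
  have "sets cantor_measure = sets (\<Pi>\<^sub>M i\<in>(UNIV :: nat set). (borel :: bool measure))"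
    unfolding cantor_measure_def
    by (rule sets_PiM_cong) (auto simp: sets_borel_eq_count_space)
  then show ?thesis
    by (simp only: sets_PiM_equal_borel)
qed

lemma emeasure_cantor_cylinder:
  assumes "finite J"
  shows "emeasure cantor_measure {x. \<forall>i\<in>J. x i = c i} = (1/2) ^ card J"
proof -
  interpret product_prob_space "\<lambda>_::nat. measure_pmf (bernoulli_pmf (1/2))" UNIV
    by unfold_locales
  have "emeasure (measure_pmf (bernoulli_pmf (1/2))) {b} = 1/2" for b
    by (cases b) (simp_all add: emeasure_pmf_single divide_ennreal_def)
  then show ?thesis
    using emeasure_PiM_Collect[of J "\<lambda>i. {c i}"] assms
    by (simp add: cantor_measure_def space_PiM)
qed

lemma ideal_E_subset: "\<lbrakk>A \<in> ideal_E; B \<subseteq> A\<rbrakk> \<Longrightarrow> B \<in> ideal_E"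
  unfolding ideal_E_def by blast

lemma ideal_E_UN_nat:
  assumes "\<And>k::nat. A k \<in> ideal_E"
  shows "(\<Union>k. A k) \<in> ideal_E"
proof -
  have "\<forall>k. \<exists>C :: nat \<Rightarrow> (nat \<Rightarrow> bool) set.
      (\<forall>n. closed (C n) \<and> C n \<in> null_sets cantor_measure) \<and> A k \<subseteq> (\<Union>n. C n)"
    using assms by (simp add: ideal_E_def)
  then obtain C :: "nat \<Rightarrow> nat \<Rightarrow> (nat \<Rightarrow> bool) set"
    where C: "\<And>k n. closed (C k n)" "\<And>k n. C k n \<in> null_sets cantor_measure"
      "\<And>k. A k \<subseteq> (\<Union>n. C k n)"
    by metis
  define D where "D p = C (fst (prod_decode p)) (snd (prod_decode p))" for p
  have "A k \<subseteq> (\<Union>p. D p)" for k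
  proof
    fix x assume "x \<in> A k"
    then obtain n where "x \<in> C k n" using C(3) by blast
    then have "x \<in> D (prod_encode (k, n))" by (simp add: D_def)
    then show "x \<in> (\<Union>p. D p)" by blast
  qed
  moreover have "\<forall>p. closed (D p) \<and> D p \<in> null_sets cantor_measure"
    using C by (simp add: D_def)
  ultimately show ?thesis
    unfolding ideal_E_def by blast
qed

lemma ideal_E_UN:
  assumes "countable I" "\<And>i. i \<in> I \<Longrightarrow> A i \<in> ideal_E"
  shows "(\<Union>i\<in>I. A i) \<in> ideal_E"
proof (cases "I = {}")
  case True
  have "{} \<in> ideal_E"
    unfolding ideal_E_def by (auto intro!: exI[of _ "\<lambda>_. {}"])
  then show ?thesis using True by simp
next
  case False
  then have "(\<Union>i\<in>I. A i) = (\<Union>k. A (from_nat_into I k))"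
    using assms(1) by (metis image_image range_from_nat_into)
  moreover have "(\<Union>k. A (from_nat_into I k)) \<in> ideal_E"
    using False by (intro ideal_E_UN_nat assms(2) from_nat_into)
  ultimately show ?thesis by simp
qed

lemma ideal_E_closed_null:
  assumes "closed P" "P \<in> null_sets cantor_measure" "A \<subseteq> P"
  shows "A \<in> ideal_E"
  using assms unfolding ideal_E_def by (auto intro!: exI[of _ "\<lambda>_. P"])

lemma UNIV_notin_ideal_E: "UNIV \<notin> ideal_E"
proof
  assume "UNIV \<in> ideal_E"
  then obtain C :: "nat \<Rightarrow> (nat \<Rightarrow> bool) set"
    where C: "\<And>n. C n \<in> null_sets cantor_measure" "UNIV \<subseteq> (\<Union>n. C n)"
    unfolding ideal_E_def by blast
  then have "UNIV \<in> null_sets cantor_measure"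
    using null_sets_UN[of C] by (simp add: top.extremum_unique)
  moreover have "emeasure cantor_measure UNIV = 1"
    using emeasure_cantor_cylinder[of "{}"] by simp
  ultimately show False by auto
qed

text \<open>
  Any \<open>n\<close> of the constrained coordinates already confine \<open>P\<close> to a cylinder of measure $2^{-n}$.
\<close>

lemma closed_null_of_constrained_coordinates:
  assumes "closed P" "infinite J" "\<And>x j. \<lbrakk>x \<in> P; j \<in> J\<rbrakk> \<Longrightarrow> x j = c j"
  shows "P \<in> null_sets cantor_measure"
proof -
  have le: "emeasure cantor_measure P \<le> ennreal ((1/2) ^ n)" for n
  proof -
    obtain K where K: "finite K" "card K = n" "K \<subseteq> J"
      using infinite_arbitrarily_large[OF assms(2)] by blast
    let ?Q = "{x. \<forall>i\<in>K. x i = c i}"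
    have "?Q = (\<Inter>i\<in>K. (\<lambda>x. x i) -` {c i})" by auto
    moreover have "closed (\<Inter>i\<in>K. (\<lambda>x::nat \<Rightarrow> bool. x i) -` {c i})"
      by (intro closed_INT ballI closed_vimage continuous_on_product_coordinates)
        (simp add: closed_def discrete_topology_class.open_discrete)
    ultimately have "?Q \<in> sets cantor_measure"
      by (simp add: sets_cantor_measure)
    moreover have "P \<subseteq> ?Q" using assms(3) K(3) by blast
    ultimately have "emeasure cantor_measure P \<le> emeasure cantor_measure ?Q"
      by (rule emeasure_mono[rotated])
    also have "\<dots> = ennreal ((1/2) ^ n)"
      using emeasure_cantor_cylinder[OF K(1)] K(2)
      by (simp add: ennreal_power[symmetric] divide_ennreal_def)
    finally show ?thesis .
  qed
  have "(\<lambda>n. ennreal ((1/2) ^ n)) \<longlonglongrightarrow> ennreal 0"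
    by (intro tendsto_ennrealI LIMSEQ_realpow_zero) auto
  then have "emeasure cantor_measure P \<le> ennreal 0"
    by (rule LIMSEQ_le_const) (use le in blast)
  then show ?thesis
    using assms(1) by (auto simp: sets_cantor_measure)
qed

text \<open>
  If at infinitely many coordinates \<open>t\<close> some value \<open>c t\<close> is missed, then all elements of \<open>A\<close> take
  the opposite value there, and the set of all such points is closed and null.
\<close>

lemma eventually_both_values_of_notin_ideal_E:
  assumes "A \<notin> ideal_E"
  shows "\<forall>\<^sub>F t in sequentially. \<forall>b. \<exists>x\<in>A. x t = b"
proof (rule ccontr)
  define J where "J = {t. \<exists>b. \<forall>x\<in>A. x t \<noteq> b}"
  assume "\<not> ?thesis"
  then have "\<exists>\<^sub>F t in sequentially. \<not> (\<forall>b. \<exists>x\<in>A. x t = b)"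
    by (simp only: not_eventually)
  then have J: "infinite J"
    by (simp add: J_def cofinite_eq_sequentially[symmetric] frequently_cofinite)
  have "\<forall>t\<in>J. \<exists>b. \<forall>x\<in>A. x t \<noteq> b" by (simp add: J_def)
  then obtain c where c: "\<forall>t\<in>J. \<forall>x\<in>A. x t \<noteq> c t"
    by (rule bchoice[THEN exE])
  define P where "P = (\<Inter>t\<in>J. (\<lambda>x::nat \<Rightarrow> bool. x t) -` {\<not> c t})"
  have "closed P"
    unfolding P_def
    by (intro closed_INT ballI closed_vimage continuous_on_product_coordinates)
      (simp add: closed_def discrete_topology_class.open_discrete)
  moreover have "P \<in> null_sets cantor_measure"
    by (rule closed_null_of_constrained_coordinates[OF \<open>closed P\<close> J, of "\<lambda>t. \<not> c t"])
      (simp add: P_def)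
  moreover have "A \<subseteq> P" using c by (auto simp: P_def)
  ultimately show False
    using ideal_E_closed_null[of P A] assms by simp
qed

section \<open>Borel sets are analytic\<close>

text \<open>
  These are the analytic sets, as projections of closed sets along the Baire space. This form makes
  closure under countable unions and intersections a mere coding of witnesses, without gluing
  continuous parametrisations.
\<close>

definition suslin :: "'a::topological_space set \<Rightarrow> bool" where
  "suslin A \<longleftrightarrow> (\<exists>C :: ('a \<times> (nat \<Rightarrow> nat)) set. closed C \<and> A = fst ` C)"

lemma suslin_closed:
  assumes "closed A"
  shows "suslin A"
  unfolding suslin_def
  by (rule exI[of _ "A \<times> UNIV"]) (use assms in \<open>auto intro: closed_Times\<close>)

text \<open>
  The first entry of the witness says which of the sets the point belongs to; the other entries
  are the witness for that.
\<close>

lemma suslin_UN: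
  fixes A :: "nat \<Rightarrow> 'a::topological_space set"
  assumes "\<And>k. suslin (A k)"
  shows "suslin (\<Union>k. A k)"
proof -
  obtain C :: "nat \<Rightarrow> ('a \<times> (nat \<Rightarrow> nat)) set"
    where C: "\<And>k. closed (C k)" "\<And>k. A k = fst ` C k"
    using assms unfolding suslin_def by metis
  let ?s = "\<lambda>p :: 'a \<times> (nat \<Rightarrow> nat). (fst p, \<lambda>n. snd p (Suc n))"
  let ?D = "\<Inter>k. {p. snd p 0 \<noteq> k} \<union> ?s -` C k"
  have coord: "continuous_on UNIV (\<lambda>p :: 'a \<times> (nat \<Rightarrow> nat). snd p n)" for n
    by (rule continuous_on_compose2[OF continuous_on_product_coordinates continuous_on_snd])
      (auto intro: continuous_intros)
  have "closed {p :: 'a \<times> (nat \<Rightarrow> nat). snd p 0 \<noteq> k}" for k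
    using closed_vimage[OF _ coord[of 0], of "- {k}"]
    by (simp add: closed_def[of "- {k}"] discrete_topology_class.open_discrete vimage_def)
  moreover have "continuous_on UNIV ?s"
    by (intro continuous_on_Pair continuous_on_coordinatewise_then_product coord)
      (auto intro: continuous_intros)
  ultimately have "closed ?D"
    by (intro closed_INT ballI closed_Un closed_vimage C) auto
  moreover have "(\<Union>k. A k) = fst ` ?D"
  proof (intro equalityI subsetI)
    fix x assume "x \<in> (\<Union>k. A k)"
    then obtain k z where "(x, z) \<in> C k" by (auto simp: C(2))
    then have "(x, case_nat k z) \<in> ?D" by auto
    then show "x \<in> fst ` ?D" by (rule image_eqI[rotated]) simp
  next
    fix x assume "x \<in> fst ` ?D"
    then obtain z where "(x, \<lambda>n. z (Suc n)) \<in> C (z 0)" by auto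
    then show "x \<in> (\<Union>k. A k)" by (force simp: C(2))
  qed
  ultimately show ?thesis unfolding suslin_def by blast
qed

text \<open>
  A sequence of witnesses, one for each set, is coded as a single one by the pairing function.
\<close>

lemma suslin_INT:
  fixes A :: "nat \<Rightarrow> 'a::topological_space set"
  assumes "\<And>k. suslin (A k)"
  shows "suslin (\<Inter>k. A k)"
proof -
  obtain C :: "nat \<Rightarrow> ('a \<times> (nat \<Rightarrow> nat)) set"
    where C: "\<And>k. closed (C k)" "\<And>k. A k = fst ` C k"
    using assms unfolding suslin_def by metis
  let ?s = "\<lambda>k (p :: 'a \<times> (nat \<Rightarrow> nat)). (fst p, \<lambda>n. snd p (prod_encode (k, n)))"
  let ?D = "\<Inter>k. ?s k -` C k"
  have coord: "continuous_on UNIV (\<lambda>p :: 'a \<times> (nat \<Rightarrow> nat). snd p n)" for n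
    by (rule continuous_on_compose2[OF continuous_on_product_coordinates continuous_on_snd])
      (auto intro: continuous_intros)
  have "continuous_on UNIV (?s k)" for k
    by (intro continuous_on_Pair continuous_on_coordinatewise_then_product coord)
      (auto intro: continuous_intros)
  then have "closed ?D"
    by (intro closed_INT ballI closed_vimage C) auto
  moreover have "(\<Inter>k. A k) = fst ` ?D"
  proof (intro equalityI subsetI)
    fix x assume "x \<in> (\<Inter>k. A k)"
    then have "\<forall>k. \<exists>z. (x, z) \<in> C k" by (fastforce simp: C(2))
    then obtain z where "\<And>k. (x, z k) \<in> C k" by metis
    then have "(x, \<lambda>m. z (fst (prod_decode m)) (snd (prod_decode m))) \<in> ?D" by simp
    then show "x \<in> fst ` ?D" by (rule image_eqI[rotated]) simp
  qed (auto simp: C(2) image_iff, metis fst_conv)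
  ultimately show ?thesis unfolding suslin_def by blast
qed

text \<open>
  The analytic sets with analytic complement form a \<open>\<sigma>\<close>-algebra, and it contains the sets that
  depend on one coordinate only, since these are clopen.
\<close>

lemma suslin_borel:
  assumes "X \<in> sets (borel :: (nat \<Rightarrow> bool) measure)"
  shows "suslin X"
proof -
  have "X \<in> sets (\<Pi>\<^sub>M i\<in>(UNIV :: nat set). (borel :: bool measure))"
    using assms by (simp only: sets_PiM_equal_borel)
  then have "X \<in> sigma_sets UNIV {{f :: nat \<Rightarrow> bool. f i \<in> A} | i A. A \<in> sets borel}"
    by (simp add: sets_PiM_single)
  then have "suslin X \<and> suslin (- X)"
  proof induction
    case (Basic a)
    then obtain i A where a: "a = (\<lambda>f. f i) -` A" by auto
    have "closed ((\<lambda>f :: nat \<Rightarrow> bool. f i) -` A)" for A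
      by (intro closed_vimage continuous_on_product_coordinates)
        (simp add: closed_def discrete_topology_class.open_discrete)
    from this[of A] this[of "- A"] show ?case
      by (auto simp: a vimage_Compl intro: suslin_closed)
  next
    case Empty
    show ?case by (auto intro: suslin_closed)
  next
    case (Compl a)
    then show ?case by (simp add: Compl_eq_Diff_UNIV[symmetric])
  next
    case (Union a)
    then show ?case by (auto simp: Compl_UN intro: suslin_UN suslin_INT)
  qed
  then show ?thesis ..
qed

text \<open>
  The product of the Cantor space and the Baire space is a copy of the Baire space: a natural
  number codes a bit (its parity) and a natural number (its half).
\<close>

lemma suslin_continuous_image:
  fixes A :: "(nat \<Rightarrow> bool) set"
  assumes "suslin A"
  obtains C :: "(nat \<Rightarrow> nat) set" and h :: "(nat \<Rightarrow> nat) \<Rightarrow> nat \<Rightarrow> bool"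
  where "closed C" "continuous_on UNIV h" "A = h ` C"
proof -
  obtain C :: "((nat \<Rightarrow> bool) \<times> (nat \<Rightarrow> nat)) set" where C: "closed C" "A = fst ` C"
    using assms unfolding suslin_def by blast
  let ?h = "\<lambda>w :: nat \<Rightarrow> nat. \<lambda>n. odd (w n)"
  let ?d = "\<lambda>w :: nat \<Rightarrow> nat. (?h w, \<lambda>n. w n div 2)"
  have cont: "continuous_on UNIV (\<lambda>w :: nat \<Rightarrow> nat. f (w n))"
    for f :: "nat \<Rightarrow> 'b::topological_space" and n
    by (rule continuous_on_compose2[OF _ continuous_on_product_coordinates]) (auto)
  have h: "continuous_on UNIV ?h"
    by (intro continuous_on_coordinatewise_then_product cont)
  moreover have "continuous_on UNIV ?d"
    by (intro continuous_on_Pair h) (intro continuous_on_coordinatewise_then_product cont)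
  then have "closed (?d -` C)"
    by (intro closed_vimage C)
  moreover have "A = ?h ` (?d -` C)"
  proof (intro equalityI subsetI)
    fix x assume "x \<in> A"
    then obtain z where z: "(x, z) \<in> C" by (auto simp: C(2))
    let ?w = "\<lambda>n. 2 * z n + of_bool (x n)"
    have "?d ?w = (x, z)" by auto
    have "x = ?h ?w" by auto
    moreover have "?w \<in> ?d -` C" using \<open>?d ?w = (x, z)\<close> z by simp
    ultimately show "x \<in> ?h ` (?d -` C)" by (rule image_eqI)
  next
    fix x assume "x \<in> ?h ` (?d -` C)"
    then obtain w where "?d w \<in> C" "x = ?h w" by blast
    then show "x \<in> A" unfolding C(2) by (intro image_eqI[of _ _ "?d w"]) simp_all
  qed
  ultimately show thesis by (intro that)
qed

section \<open>Fusion\<close>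

definition cyl :: "(nat \<Rightarrow> nat) \<Rightarrow> nat \<Rightarrow> (nat \<Rightarrow> nat) set" where
  "cyl c n = {z. \<forall>i<n. z i = c i}"

lemma cyl_antimono: "m \<le> n \<Longrightarrow> cyl c n \<subseteq> cyl c m"
  by (auto simp: cyl_def)

lemma open_contains_cyl:
  assumes "open U" "c \<in> U"
  obtains n where "cyl c n \<subseteq> U"
proof -
  obtain X where X: "c \<in> Pi\<^sub>E UNIV X" "finite {i. X i \<noteq> UNIV}" "Pi\<^sub>E UNIV X \<subseteq> U"
    using product_topology_open_contains_basis[of "\<lambda>_. euclidean" UNIV U c] assms
    by (auto simp: open_fun_def)
  obtain n where n: "{i. X i \<noteq> UNIV} \<subseteq> {..<n}"
    using X(2) finite_nat_iff_bounded by blast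
  have "z i \<in> X i" if "z \<in> cyl c n" for z i
  proof (cases "i < n")
    case True
    then have "z i = c i" using that by (simp add: cyl_def)
    then show ?thesis using PiE_mem[OF X(1)] by simp
  next
    case False
    then have "X i = UNIV" using n by blast
    then show ?thesis by simp
  qed
  then have "cyl c n \<subseteq> Pi\<^sub>E UNIV X" by auto
  then show thesis using X(3) by (rule that[OF order_trans])
qed

lemma countable_cylinders: "countable (range (\<lambda>(c, n). cyl c n))"
proof -
  define f where "f l = {z. \<forall>i<length l. z i = l ! i}" for l :: "nat list"
  have "cyl c n = f (map c [0..<n])" for c n
    by (simp add: cyl_def f_def)
  then have "range (\<lambda>(c, n). cyl c n) \<subseteq> range f"
    by (simp add: image_subset_iff split_beta)
  then show ?thesis by (rule countable_subset) simp
qed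

text \<open>
  Only countably many cylinders exist, so the points of \<open>C\<close> that have a neighbourhood with image in
  \<open>\<E>\<close> have together an image in \<open>\<E>\<close>. Removing them from \<open>C\<close> changes the images of \<open>C\<close> and of its
  parts only by a set in \<open>\<E>\<close>, so the remaining points are still large in every neighbourhood.
\<close>

lemma everywhere_large_kernel:
  fixes h :: "(nat \<Rightarrow> nat) \<Rightarrow> nat \<Rightarrow> bool"
  assumes "h ` C \<notin> ideal_E"
  shows "\<exists>B\<subseteq>C. B \<noteq> {} \<and> (\<forall>c\<in>B. \<forall>n. h ` (B \<inter> cyl c n) \<notin> ideal_E)"
proof -
  define B where "B = {c \<in> C. \<forall>n. h ` (C \<inter> cyl c n) \<notin> ideal_E}"
  let ?I = "{N \<in> range (\<lambda>(c, n). cyl c n). h ` (C \<inter> N) \<in> ideal_E}"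
  have "countable ?I"
    by (rule countable_subset[OF _ countable_cylinders]) blast
  then have "(\<Union>N\<in>?I. h ` (C \<inter> N)) \<in> ideal_E"
    by (rule ideal_E_UN) blast
  moreover have "h ` (C - B) \<subseteq> (\<Union>N\<in>?I. h ` (C \<inter> N))"
  proof
    fix x assume "x \<in> h ` (C - B)"
    then obtain c n where "c \<in> C" "x = h c" "h ` (C \<inter> cyl c n) \<in> ideal_E"
      by (auto simp: B_def)
    then show "x \<in> (\<Union>N\<in>?I. h ` (C \<inter> N))"
      by (intro UN_I[of "cyl c n"]) (auto simp: cyl_def)
  qed
  ultimately have small: "h ` (C - B) \<in> ideal_E"
    by (rule ideal_E_subset)
  have transfer: "h ` (C \<inter> N) \<in> ideal_E" if "h ` (B \<inter> N) \<in> ideal_E" for N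
  proof -
    have "(\<Union>b::bool. if b then h ` (B \<inter> N) else h ` (C - B)) \<in> ideal_E"
      using that small by (intro ideal_E_UN) auto
    then show ?thesis
      by (rule ideal_E_subset) (auto simp: UN_bool_eq)
  qed
  have "B \<subseteq> C" by (auto simp: B_def)
  moreover have "B \<noteq> {}" using small assms by auto
  moreover have "h ` (B \<inter> cyl c n) \<notin> ideal_E" if "c \<in> B" for c n
  proof -
    have "h ` (C \<inter> cyl c n) \<notin> ideal_E" using that by (simp add: B_def)
    then show ?thesis using transfer by blast
  qed
  ultimately show ?thesis by (intro exI[of _ B]) simp
qed

text \<open>
  One level of the tree. The nodes of the current level are the points of \<open>A\<close>, each with the
  cylinder given by its first \<open>m\<close> entries. Finiteness of \<open>A\<close> allows a coordinate \<open>t'\<close> and a length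
  \<open>m'\<close> common to all nodes; the successors of \<open>c\<close> are \<open>G c False\<close> and \<open>G c True\<close>.
\<close>

lemma fusion_step:
  fixes h :: "(nat \<Rightarrow> nat) \<Rightarrow> nat \<Rightarrow> bool"
  assumes h: "continuous_on UNIV h"
    and B: "\<And>c n. c \<in> B \<Longrightarrow> h ` (B \<inter> cyl c n) \<notin> ideal_E"
    and A: "finite A" "A \<subseteq> B"
  shows "\<exists>t'>t. \<exists>m'>m. \<exists>G. \<forall>c\<in>A. \<forall>b.
      G c b \<in> B \<inter> cyl c m \<and> (\<forall>z\<in>cyl (G c b) m'. h z t' = b)"
proof -
  have "\<forall>\<^sub>F t' in sequentially. \<forall>c\<in>A. \<forall>b. \<exists>x\<in>h ` (B \<inter> cyl c m). x t' = b"
    using A B by (intro eventually_ball_finite ballI eventually_both_values_of_notin_ideal_E) auto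
  then obtain t' where t': "t' > t" "\<forall>c\<in>A. \<forall>b. \<exists>x\<in>h ` (B \<inter> cyl c m). x t' = b"
    using eventually_happens[OF eventually_conj[OF eventually_gt_at_top[of t]]] by force
  then have "\<forall>c\<in>A. \<forall>b. \<exists>d\<in>B \<inter> cyl c m. h d t' = b" by simp
  then obtain G where G: "\<And>c b. c \<in> A \<Longrightarrow> G c b \<in> B \<inter> cyl c m" "\<And>c b. c \<in> A \<Longrightarrow> h (G c b) t' = b"
    by metis
  have ev: "\<forall>\<^sub>F m' in sequentially. \<forall>z\<in>cyl (G c b) m'. h z t' = b" if "c \<in> A" for c b
  proof -
    have "open ((\<lambda>z. h z t') -` {b})"
      by (intro open_vimage continuous_on_product_then_coordinatewise[OF h])
        (simp add: discrete_topology_class.open_discrete)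
    moreover have "G c b \<in> (\<lambda>z. h z t') -` {b}" using G(2)[OF that] by simp
    ultimately obtain k where k: "cyl (G c b) k \<subseteq> (\<lambda>z. h z t') -` {b}"
      by (rule open_contains_cyl)
    show ?thesis
      using eventually_ge_at_top[of k]
      by eventually_elim (use k cyl_antimono in blast)
  qed
  have "\<forall>\<^sub>F m' in sequentially. \<forall>c\<in>A. \<forall>b\<in>UNIV. \<forall>z\<in>cyl (G c b) m'. h z t' = b"
    using A(1) ev by (intro eventually_ball_finite ballI) auto
  then obtain m' where m': "m' > m" "\<forall>c\<in>A. \<forall>b\<in>UNIV. \<forall>z\<in>cyl (G c b) m'. h z t' = b"
    using eventually_happens[OF eventually_conj[OF eventually_gt_at_top[of m]]] by force
  have "\<forall>c\<in>A. \<forall>b. G c b \<in> B \<inter> cyl c m \<and> (\<forall>z\<in>cyl (G c b) m'. h z t' = b)"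
    using G(1) m'(2) by simp
  with t'(1) m'(1) show ?thesis by blast
qed

text \<open>
  The tree is not indexed by finite 0-1 sequences. Instead, \<open>F n y\<close> is the node of level \<open>n\<close> on the
  branch that belongs to \<open>y\<close>; that only finitely many nodes occur on a level is stated as finiteness
  of the range of \<open>F n\<close>. The successor of \<open>F n y\<close> is chosen by the bit \<open>y n\<close>.
\<close>

lemma fusion:
  fixes h :: "(nat \<Rightarrow> nat) \<Rightarrow> nat \<Rightarrow> bool"
  assumes h: "continuous_on UNIV h" and C: "closed C" and large: "h ` C \<notin> ideal_E"
  shows "\<exists>t :: nat \<Rightarrow> nat. strict_mono t \<and> (\<forall>y. \<exists>z\<in>C. \<forall>n. h z (t n) = y n)"
proof -
  obtain B where B: "B \<subseteq> C" "B \<noteq> {}" "\<And>c n. c \<in> B \<Longrightarrow> h ` (B \<inter> cyl c n) \<notin> ideal_E"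
    using everywhere_large_kernel[OF large] by blast
  define P where "P = (\<lambda>(_::nat) (F :: (nat \<Rightarrow> bool) \<Rightarrow> nat \<Rightarrow> nat, m :: nat, t :: nat).
      finite (range F) \<and> range F \<subseteq> B)"
  define Q where "Q = (\<lambda>n (F :: (nat \<Rightarrow> bool) \<Rightarrow> nat \<Rightarrow> nat, m :: nat, t :: nat)
        (F' :: (nat \<Rightarrow> bool) \<Rightarrow> nat \<Rightarrow> nat, m' :: nat, t' :: nat).
      t < t' \<and> m < m' \<and> (\<forall>y. F' y \<in> cyl (F y) m) \<and> (\<forall>y. \<forall>z\<in>cyl (F' y) m'. h z t' = y n))"
  have "\<exists>s. \<forall>n. P n (s n) \<and> Q n (s n) (s (Suc n))"
  proof (rule dependent_nat_choice)
    obtain c where "c \<in> B" using B(2) by blast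
    then have "P 0 (\<lambda>_. c, 0, 0)" by (auto simp: P_def)
    then show "\<exists>s. P 0 s" ..
  next
    fix s n assume "P n s"
    obtain F m t where s: "s = (F, m, t)" by (cases s)
    with \<open>P n s\<close> have F: "finite (range F)" "range F \<subseteq> B" by (auto simp: P_def)
    obtain t' m' G where tm: "t' > t" "m' > m"
      and G: "\<forall>c\<in>range F. \<forall>b. G c b \<in> B \<inter> cyl c m \<and> (\<forall>z\<in>cyl (G c b) m'. h z t' = b)"
      using fusion_step[OF h B(3) F, of t m] by blast
    let ?F' = "\<lambda>y. G (F y) (y n)"
    have "range ?F' \<subseteq> (\<lambda>(c, b). G c b) ` (range F \<times> UNIV)" by auto
    then have "finite (range ?F')"
      by (rule finite_subset) (use F(1) in simp)
    then have "P (Suc n) (?F', m', t')"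
      using G by (auto simp: P_def)
    moreover have "h z t' = y n" if "z \<in> cyl (?F' y) m'" for y z
      using G that by blast
    then have "Q n s (?F', m', t')"
      using tm G by (simp add: Q_def s)
    ultimately show "\<exists>s'. P (Suc n) s' \<and> Q n s s'" by blast
  qed
  then obtain s where s: "\<And>n. P n (s n)" "\<And>n. Q n (s n) (s (Suc n))" by blast
  define F m u where "F n = fst (s n)" and "m n = fst (snd (s n))" and "u n = snd (snd (s n))" for n
  have F_B: "F n y \<in> B" for n y
  proof -
    have "P n (F n, m n, u n)" using s(1) by (simp add: F_def m_def u_def)
    then show ?thesis by (auto simp: P_def)
  qed
  have Q: "Q n (F n, m n, u n) (F (Suc n), m (Suc n), u (Suc n))" for n
    using s(2) by (simp add: F_def m_def u_def)
  have m: "strict_mono m" and "strict_mono u"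
    using Q by (simp_all add: strict_mono_Suc_iff Q_def)
  have refine: "F (Suc n) y \<in> cyl (F n y) (m n)" for n y
    using Q[of n] by (simp add: Q_def)
  have decide: "h z (u (Suc n)) = y n" if "z \<in> cyl (F (Suc n) y) (m (Suc n))" for n y z
    using Q[of n] that by (simp add: Q_def)
  have "\<exists>z\<in>C. \<forall>n. h z (u (Suc n)) = y n" for y
  proof -
    \<comment> \<open>The limit of the branch: the \<open>i\<close>-th entry no longer changes from level \<open>Suc i\<close> on, as
        \<open>i < m (Suc i)\<close>.\<close>
    define z where "z i = F (Suc i) y i" for i
    have stable: "F n' y i = F n y i" if "n \<le> n'" "i < m n" for n n' i
      using that(1)
    proof (induction n' rule: dec_induct)
      case (step k)
      have "i < m k"
        using that(2) step(1) strict_mono_less_eq[OF m, of n k] by linarith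
      then show ?case
        using step.IH refine[of k y] by (simp add: cyl_def)
    qed simp
    have z: "z \<in> cyl (F n y) (m n)" for n
      unfolding cyl_def
    proof safe
      fix i assume "i < m n"
      have "i < m (Suc i)"
        using strict_mono_imp_increasing[OF m, of "Suc i"] by linarith
      then show "z i = F n y i"
        using stable[of "Suc i" n i] stable[of n "Suc i" i] \<open>i < m n\<close>
        by (cases "n \<le> Suc i") (auto simp: z_def)
    qed
    have "z \<in> C"
    proof (rule ccontr)
      assume "z \<notin> C"
      then obtain k where k: "cyl z k \<subseteq> - C"
        using open_contains_cyl[of "- C" z] C by auto
      have "k \<le> m k" by (rule strict_mono_imp_increasing[OF m])
      then have "F k y \<in> cyl z k"
        using z[of k] by (simp add: cyl_def)
      with k F_B[of k y] B(1) show False by blast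
    qed
    with decide z show ?thesis by blast
  qed
  moreover have "strict_mono (\<lambda>n. u (Suc n))"
    using \<open>strict_mono u\<close> by (simp add: strict_mono_Suc_iff)
  ultimately show ?thesis by (intro exI[of _ "\<lambda>n. u (Suc n)"]) simp
qed

section \<open>Restrictions to infinite sets\<close>

text \<open>
  Under the identification of $2^S$ with the Cantor space, restricting to \<open>S\<close> is composing with the
  enumeration of \<open>S\<close>, which is a continuous operation.
\<close>

lemma tilde_vimage_restr:
  assumes "infinite S"
  shows "tilde S -` restr X S = (\<lambda>x i. x (enumerate S i)) ` X"
proof (intro equalityI subsetI)
  fix x assume "x \<in> tilde S -` restr X S"
  then obtain w where w: "w \<in> X" "tilde S x = restrict w S" by (auto simp: restr_def)
  have "x i = w (enumerate S i)" for i
    using tilde_enumerate[OF assms, of x i] enumerate_in_set[OF assms, of i] w(2) by simp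
  with w(1) show "x \<in> (\<lambda>x i. x (enumerate S i)) ` X" by blast
next
  fix x assume "x \<in> (\<lambda>x i. x (enumerate S i)) ` X"
  then obtain w where w: "w \<in> X" "x = (\<lambda>i. w (enumerate S i))" by blast
  have "tilde S x = restrict w S"
  proof
    fix n
    show "tilde S x n = restrict w S n"
    proof (cases "n \<in> S")
      case True
      then obtain i where "n = enumerate S i" using range_enumerate[OF assms] by blast
      then show ?thesis using True by (simp add: tilde_enumerate[OF assms] w(2))
    qed (simp add: tilde_def)
  qed
  with w(1) show "x \<in> tilde S -` restr X S" by (simp add: restr_def)
qed

lemma restr_subset_cantor_on: "restr X S \<subseteq> cantor_on S"
  by (auto simp: restr_def cantor_on_def)

lemma class_EE_subset_class_P2: "class_EE \<subseteq> class_P2"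
proof
  fix X assume X: "X \<in> class_EE"
  have "restr X S \<noteq> cantor_on S" if S: "infinite S" for S
  proof
    assume "restr X S = cantor_on S"
    then have "tilde S -` restr X S = UNIV"
      using bij_betw_tilde[OF S] by (auto simp: bij_betw_def)
    moreover have "tilde S -` restr X S \<in> ideal_E"
      using X S by (auto simp: class_EE_def ideal_E_on_def)
    ultimately show False using UNIV_notin_ideal_E by simp
  qed
  then show "X \<in> class_P2" by (simp add: class_P2_def)
qed

text \<open>
  Fusion is applied to \<open>h\<close> followed by restriction to \<open>S\<close>, where \<open>h\<close> parametrises \<open>X\<close>. The
  coordinates it provides are positions in \<open>S\<close>, and \<open>u\<close> lists the elements of \<open>S\<close> there.
\<close>

lemma suslin_class_P2_in_class_EE:
  assumes X: "suslin X" "X \<in> class_P2"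
  shows "X \<in> class_EE"
proof (rule ccontr)
  assume "X \<notin> class_EE"
  then obtain S where S: "infinite S" and "restr X S \<notin> ideal_E_on S"
    unfolding class_EE_def by blast
  then have large: "(\<lambda>x i. x (enumerate S i)) ` X \<notin> ideal_E"
    using restr_subset_cantor_on by (simp add: ideal_E_on_def tilde_vimage_restr)
  obtain C :: "(nat \<Rightarrow> nat) set" and h
    where C: "closed C" "continuous_on UNIV h" "X = h ` C"
    using X(1) by (rule suslin_continuous_image)
  have cont: "continuous_on UNIV (\<lambda>z i. h z (enumerate S i))"
    by (rule continuous_on_coordinatewise_then_product)
      (rule continuous_on_product_then_coordinatewise[OF C(2)])
  have "(\<lambda>z i. h z (enumerate S i)) ` C \<notin> ideal_E"
    using large by (simp add: C(3) image_image)
  from fusion[OF cont C(1) this] obtain t where t: "strict_mono (t :: nat \<Rightarrow> nat)"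
      "\<forall>y. \<exists>z\<in>C. \<forall>n. h z (enumerate S (t n)) = y n"
    by blast
  define u where "u n = enumerate S (t n)" for n
  have "inj u"
    using strict_mono_enumerate[OF S] t(1)
    by (simp add: u_def inj_def strict_mono_eq)
  then have "infinite (range u)" by (rule range_inj_infinite)
  moreover have "restr X (range u) = cantor_on (range u)"
  proof (rule equalityI[OF restr_subset_cantor_on subsetI])
    fix y assume y: "y \<in> cantor_on (range u)"
    have "\<exists>z\<in>C. \<forall>n. h z (u n) = y (u n)"
      unfolding u_def using t(2) by (rule spec)
    then obtain z where z: "z \<in> C" "\<And>n. h z (u n) = y (u n)" by blast
    have "y = restrict (h z) (range u)"
    proof
      fix k
      show "y k = restrict (h z) (range u) k"
      proof (cases "k \<in> range u")
        case True
        then obtain n where "k = u n" by blast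
        then show ?thesis by (simp add: z(2))
      next
        case False
        then show ?thesis using PiE_arb[OF y[unfolded cantor_on_def]] by simp
      qed
    qed
    then show "y \<in> restr X (range u)"
      unfolding restr_def C(3) image_image using z(1) by (rule image_eqI)
  qed
  ultimately show False
    using X(2) by (simp add: class_P2_def)
qed

theorem theorem3p9:
  shows "class_EE \<inter> sets (borel :: (nat \<Rightarrow> bool) measure)
       = class_P2 \<inter> sets (borel :: (nat \<Rightarrow> bool) measure)"
  using class_EE_subset_class_P2 suslin_class_P2_in_class_EE suslin_borel by blast

end
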